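(* Let $r>2$ and $\alpha\ge 0$, and consider $f\in H^2(\mathbb{D}^2)$ given by $$f(z_1,z_2)=\left(\frac{1}{1-\frac{z_1+z_2}{r}}\right)^{\alpha}.$$ Denote the Fourier coefficients of $|f|^2$ by $c_{k_1,k_2}$, $k_1,k_2\in\mathbb{Z}$. Then, for all integers $k_1,k_2\ge 0$, $$c_{k_1,k_2}=\frac{1}{r^{k_1+k_2}}\,\frac{(\alpha)_{k_1+k_2}}{k_1!\,k_2!}\;{}_4F_3\left(\begin{matrix}\alpha,\ \alpha+k_1+k_2,\ \frac{k_1+k_2}{2}+1,\ \frac{k_1+k_2+1}{2}\\ k_1+k_2+1,\ k_1+1,\ k_2+1\end{matrix};\ \frac{4}{r^2}\right)$$ and $$c_{k_1,-k_2}=\frac{1}{r^{k_1+k_2}}\,\frac{(\alpha)_{k_1}(\alpha)_{k_2}}{k_1!\,k_2!}\;{}_4F_3\left(\begin{matrix}\alpha+k_1,\ \alpha+k_2,\ \frac{k_1+k_2+1}{2},\ \frac{k_1+k_2}{2}+1\\ k_1+1,\ k_2+1,\ k_1+k_2+1\end{matrix};\ \frac{4}{r^2}\right).$$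
   Context: $\mathbb{D}=\{z\in\mathbb{C}:|z|<1\}$ and $H^2(\mathbb{D}^2)$ is the Hardy Hilbert space on the bidisk $\mathbb{D}^2$. The power defining $f$ is the principal branch, i.e. $f(z_1,z_2)=\sum_{i=0}^\infty \frac{(\alpha)_i}{i!\,r^i}(z_1+z_2)^i$. The Fourier coefficients of $|f|^2$ are those of $|f|^2$ restricted to the torus $|z_1|=|z_2|=1$: $|f(z_1,z_2)|^2=\sum_{k_1=-\infty}^{\infty}\sum_{k_2=-\infty}^{\infty}c_{k_1,k_2}z_1^{k_1}z_2^{k_2}$ for $|z_1|=|z_2|=1$. The Pochhammer symbol is $(\alpha)_0=1$ and $(\alpha)_n=\alpha(\alpha+1)\cdots(\alpha+n-1)$ for $n>0$. For $|z|<1$ the hypergeometric function is $${}_pF_q\left(\begin{matrix}a_1,\ldots,a_p\\ b_1,\ldots,b_q\end{matrix};\ z\right)=\sum_{n=0}^\infty\frac{(a_1)_n\cdots(a_p)_n}{(b_1)_n\cdots(b_q)_n}\frac{z^n}{n!}.$$ *)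

theory Defs
  imports "HOL-Analysis.Analysis"
begin

text \<open>
  The Hardy space of the bidisk: analytic functions on the bidisk whose Taylor coefficients are
  square summable. Functions are total here; only their values on the bidisk matter for
  membership.
\<close>

definition hardy_space_bidisk :: "(complex \<Rightarrow> complex \<Rightarrow> complex) set" where
  "hardy_space_bidisk =
     {g. \<exists>a :: nat \<Rightarrow> nat \<Rightarrow> complex.
           (\<lambda>(m, n). (cmod (a m n))\<^sup>2) summable_on UNIV \<and>
           (\<forall>z1 z2. cmod z1 < 1 \<and> cmod z2 < 1 \<longrightarrow>
              ((\<lambda>(m, n). a m n * z1 ^ m * z2 ^ n) has_sum g z1 z2) UNIV)}"

definition fourier_coeff :: "(complex \<Rightarrow> complex \<Rightarrow> complex) \<Rightarrow> int \<Rightarrow> int \<Rightarrow> complex" where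
  "fourier_coeff g k1 k2 =
     (LINT p : {0..2*pi} \<times> {0..2*pi} | lborel.
        g (cis (fst p)) (cis (snd p)) *
        cis (- (of_int k1 * fst p + of_int k2 * snd p))) / of_real ((2 * pi)\<^sup>2)"

text \<open>
  The complex \<open>powr\<close> is the principal power, and the base lies in the right half-plane
  whenever \<open>r > 2\<close> and \<open>z1, z2\<close> lie in the closed unit disk; so the same formula
  also gives the boundary values on the torus.
\<close>

definition pow_fun :: "real \<Rightarrow> real \<Rightarrow> complex \<Rightarrow> complex \<Rightarrow> complex" where
  "pow_fun r \<alpha> z1 z2 = (1 / (1 - (z1 + z2) / of_real r)) powr of_real \<alpha>"

text \<open>
  The last argument of \<open>fps_hypergeo\<close> rescales the variable, and the factor \<open>1 / n!\<close> is
  part of its coefficients, so \<open>hypergeo\<close> is the sum of the usual pFq series at \<open>z\<close>, meaningful where that series converges.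
\<close>

definition hypergeo :: "real list \<Rightarrow> real list \<Rightarrow> real \<Rightarrow> real" where
  "hypergeo as bs z = eval_fps (fps_hypergeo as bs 1) z"

end

theory Submission
  imports Defs
begin

text \<open>
  Expanding $(1 - w)^{-\alpha}$ at $w = (z_1 + z_2)/r$ and then each power of $z_1 + z_2$ gives the
  Taylor coefficients $a_{m,n} = (\alpha)_{m+n} / (m!\, n!\, r^{m+n})$ of $f$. They are
  nonnegative, and their sum is the value of $f$ at $(1, 1)$, where $|w| = 2/r < 1$; so the Taylor
  series converges absolutely on the closed bidisk (\<open>pow_fun_has_sum\<close>). This absolute convergence
  is what allows every regrouping and every exchange of sum and integral below.

  On the torus $\bar z = z^{-1}$, so $|f|^2 = f \bar f$ is the sum of
  $a_{m,n} a_{p,q} z_1^{m-p} z_2^{n-q}$. Collecting equal exponents gives an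
  absolutely convergent trigonometric series whose coefficients are the autocorrelation of $a$
  (\<open>has_sum_cmod_square\<close>), and these are the Fourier coefficients because the characters
  are orthogonal (\<open>fourier_coeff_absolutely_convergent\<close>).

  For $k_1, k_2 \ge 0$ the coefficient at $(k_1, k_2)$ is the sum of $a_{p+k_1,q+k_2} a_{p,q}$
  over all $p, q$, and the one at $(k_1, -k_2)$ is the sum of $a_{p+k_1,q} a_{p,q+k_2}$. In both
  cases the Pochhammer symbols and the powers of $r$ depend on $p$ and $q$ only through
  $j = p + q$, and what is left to sum over $p + q = j$ is the same product of
  reciprocal factorials. The Vandermonde convolution evaluates this sum to
  \[ \frac{(2j + k_1 + k_2)!}{(j+k_1)!\, (j+k_2)!\, j!\, (j+k_1+k_2)!}, \]
  and the duplication formula for Pochhammer symbols splits the numerator into $(k_1+k_2)!$, the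
  factor $4^j$ and the two upper parameters $\frac{k_1+k_2+1}{2}$, $\frac{k_1+k_2}{2}+1$ of the
  ${}_4F_3$
  (\<open>sum_inverse_factorials_pochhammer\<close>).
\<close>

section \<open>Regrouping unconditional sums\<close>

lemma bij_betw_antidiagonals:
  "bij_betw (\<lambda>(j, p). (p, j - p)) (SIGMA j:UNIV. {..j}) (UNIV :: (nat \<times> nat) set)"
  by (rule bij_betw_byWitness[where f' = "\<lambda>(p, q). (p + q, p)"]) auto

lemma has_sum_antidiagonals:
  fixes F :: "nat \<times> nat \<Rightarrow> 'a :: {topological_comm_monoid_add, t3_space}"
  assumes "(F has_sum S) UNIV"
  shows "((\<lambda>j. \<Sum>p\<le>j. F (p, j - p)) has_sum S) UNIV"
proof (rule has_sum_SigmaD)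
  have "((\<lambda>x. F (case x of (j, p) \<Rightarrow> (p, j - p))) has_sum S) (SIGMA j:UNIV. {..j})"
    using assms has_sum_reindex_bij_betw[OF bij_betw_antidiagonals, of F S] by simp
  then show "((\<lambda>(j, p). F (p, j - p)) has_sum S) (SIGMA j:UNIV. {..j})"
    by (simp add: case_prod_unfold)
qed (auto intro: has_sum_finite)

text \<open>
  Nonnegativity is essential here: in general, cancellation inside an antidiagonal can make the
  grouped series converge although the double series does not.
\<close>

lemma summable_on_antidiagonals:
  fixes F :: "nat \<times> nat \<Rightarrow> real"
  assumes "\<And>x. F x \<ge> 0" and "(\<lambda>j. \<Sum>p\<le>j. F (p, j - p)) summable_on UNIV"
  shows "F summable_on UNIV"
proof -
  have "(\<lambda>(j, p). F (p, j - p)) summable_on (SIGMA j:UNIV. {..j})"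
    by (rule summable_on_SigmaI[OF _ assms(2)]) (auto intro: has_sum_finite assms(1))
  then show ?thesis
    using summable_on_reindex_bij_betw[OF bij_betw_antidiagonals, of F]
    by (simp add: case_prod_unfold)
qed

text \<open>
  An unconditionally convergent sum may be collected along the fibres of an arbitrary map. The
  fibres are used to bring together the products of Taylor coefficients that contribute to one
  frequency.
\<close>

lemma has_sum_fibres:
  fixes F :: "'a \<Rightarrow> 'b :: {topological_comm_monoid_add, t3_space}" and \<phi> :: "'a \<Rightarrow> 'k"
  assumes "(F has_sum S) UNIV"
    and "\<And>k. (F has_sum G k) (\<phi> -` {k})"
  shows "(G has_sum S) UNIV"
proof (rule has_sum_SigmaD)
  have bij: "bij_betw snd (SIGMA k:UNIV. \<phi> -` {k}) UNIV"
    by (rule bij_betw_byWitness[where f' = "\<lambda>x. (\<phi> x, x)"]) auto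
  show "((\<lambda>x. F (snd x)) has_sum S) (SIGMA k:UNIV. \<phi> -` {k})"
    using assms(1) has_sum_reindex_bij_betw[OF bij, of F S] by simp
  show "((\<lambda>y. F (snd (k, y))) has_sum G k) (\<phi> -` {k})" for k
    using assms(2) by simp
qed

lemma summable_on_product_nonneg:
  fixes a b :: "'i \<Rightarrow> real"
  assumes "a summable_on UNIV" "b summable_on UNIV" "\<And>x. a x \<ge> 0" "\<And>x. b x \<ge> 0"
  shows "(\<lambda>(x, y). a x * b y) summable_on UNIV"
proof -
  have "(\<lambda>(x, y). a x * b y) summable_on (SIGMA x:UNIV. UNIV)"
  proof (rule summable_on_SigmaI)
    show "((\<lambda>y. case (x, y) of (x, y) \<Rightarrow> a x * b y) has_sum (a x * infsum b UNIV)) UNIV" for x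
      using has_sum_cmult_right[OF has_sum_infsum[OF assms(2)]] by simp
  qed (auto intro: summable_on_cmult_left mult_nonneg_nonneg assms)
  then show ?thesis by simp
qed

section \<open>Fourier coefficients of absolutely convergent double Fourier series\<close>

lemma integral_cis_period:
  fixes m :: int
  shows "(LINT s|lborel. indicator {0..2*pi} s *\<^sub>R cis (of_int m * s)) =
         (if m = 0 then of_real (2 * pi) else 0)"
proof (cases "m = 0")
  case False
  define F where "F = (\<lambda>s. cis (of_int m * s) / (\<i> * of_int m))"
  have "(LINT s|lborel. indicator {0..2*pi} s *\<^sub>R cis (of_int m * s)) = F (2*pi) - F 0"
  proof (rule integral_FTC_atLeastAtMost)
    \<comment> \<open>differentiate in the complex variable, then restrict to the real line\<close>
    have "((\<lambda>z. exp (\<i> * of_int m * z) / (\<i> * of_int m)) has_field_derivative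
        exp (\<i> * of_int m * z)) (at z)" for z
      using False by (auto intro!: derivative_eq_intros)
    from has_vector_derivative_real_field[OF this]
    show "(F has_vector_derivative cis (of_int m * x)) (at x within {0..2*pi})" for x
      by (simp add: F_def cis_conv_exp mult.assoc)
    show "continuous_on {0..2*pi} (\<lambda>x. cis (of_int m * x))"
      by (intro continuous_intros)
  qed auto
  also have "F (2*pi) = F 0"
    using cis_multiple_2pi[of "of_int m"] by (simp add: F_def mult.commute mult.left_commute)
  finally show ?thesis using False by simp
qed (simp add: scaleR_conv_of_real)

lemma integrable_square_continuous:
  fixes h :: "real \<times> real \<Rightarrow> complex"
  assumes "continuous_on ({0..2*pi} \<times> {0..2*pi}) h"
  shows "integrable lborel (\<lambda>p. indicator ({0..2*pi} \<times> {0..2*pi}) p *\<^sub>R h p)"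
  by (intro borel_integrable_compact compact_Times compact_Icc assms)

lemma integral_cis_square:
  fixes m n :: int
  shows "(LINT p|lborel. indicator ({0..2*pi} \<times> {0..2*pi}) p *\<^sub>R
            cis (of_int m * fst p + of_int n * snd p)) =
         (if m = 0 \<and> n = 0 then of_real ((2 * pi)\<^sup>2) else 0)"
proof -
  let ?e = "\<lambda>m s. indicator {0..2*pi} s *\<^sub>R cis (of_int m * s)"
  \<comment> \<open>the integrand separates, so Fubini reduces the claim to one variable\<close>
  have eq: "indicator ({0..2*pi} \<times> {0..2*pi}) p *\<^sub>R cis (of_int m * fst p + of_int n * snd p) =
      ?e m (fst p) * ?e n (snd p)" for p :: "real \<times> real"
    by (cases p) (auto simp: indicator_def cis_mult)
  have "integrable lborel (\<lambda>p :: real \<times> real. ?e m (fst p) * ?e n (snd p))"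
    using integrable_square_continuous[of "\<lambda>p. cis (of_int m * fst p + of_int n * snd p)"]
    unfolding eq by (simp add: continuous_intros)
  then have "(LINT p|lborel. ?e m (fst p) * ?e n (snd p)) =
      (LINT s|lborel. LINT t|lborel. ?e m s * ?e n t)"
    unfolding lborel_prod[symmetric] by (subst lborel_pair.integral_fst'[symmetric]) auto
  also have "\<dots> = (LINT s|lborel. ?e m s) * (LINT t|lborel. ?e n t)"
    by (simp only: integral_mult_right_zero integral_mult_left_zero)
  also have "\<dots> = (if m = 0 \<and> n = 0 then of_real ((2 * pi)\<^sup>2) else 0)"
    unfolding integral_cis_period by (auto simp: power2_eq_square)
  finally show ?thesis unfolding eq .
qed

lemma cis_powi: "cis t powi k = cis (of_int k * t)"
  by (simp add: cis_power_int)

text \<open>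
  Multiplying the series by a character keeps the norms of its terms, so these are bounded on the
  square by a convergent series of constants. This permits term-by-term integration, and by
  orthogonality only the term at the given frequency survives.
\<close>

lemma fourier_coeff_absolutely_convergent:
  fixes d :: "int \<times> int \<Rightarrow> complex"
  assumes abs: "(\<lambda>k. cmod (d k)) summable_on UNIV"
    and g: "\<And>z1 z2. cmod z1 = 1 \<Longrightarrow> cmod z2 = 1 \<Longrightarrow>
        ((\<lambda>(k1, k2). d (k1, k2) * z1 powi k1 * z2 powi k2) has_sum g z1 z2) UNIV"
  shows "fourier_coeff g k1 k2 = d (k1, k2)"
proof -
  define A :: "(real \<times> real) set" where "A = {0..2*pi} \<times> {0..2*pi}"
  \<comment> \<open>listing the frequencies in a sequence turns the unconditional sum into an ordinary series\<close>
  define h :: "nat \<Rightarrow> int \<times> int" where "h = from_nat_into UNIV"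
  have h: "bij_betw h UNIV UNIV"
    unfolding h_def by (intro bij_betw_from_nat_into) (auto simp: finite_prod)
  define E where "E i p = cis (of_int (fst (h i) - k1) * fst p + of_int (snd (h i) - k2) * snd p)"
    for i and p :: "real \<times> real"
  define F where "F i p = d (h i) * (indicator A p *\<^sub>R E i p)" for i p
  have sm: "summable (\<lambda>i. cmod (d (h i)))"
    using abs summable_on_reindex_bij_betw[OF h, of "\<lambda>k. cmod (d k)"]
    by (auto dest: summable_on_imp_summable)
  have normF: "norm (F i p) = indicator A p * cmod (d (h i))" for i p
    by (simp add: F_def E_def norm_mult)
  have int_E: "integrable lborel (\<lambda>p. indicator A p *\<^sub>R E i p)" for i
    unfolding A_def E_def by (intro integrable_square_continuous continuous_intros)
  have int_F: "integrable lborel (F i)" for i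
    unfolding F_def by (intro integrable_mult_right int_E)
  have series: "(\<lambda>i. F i p) sums (indicator A p *\<^sub>R
      (g (cis (fst p)) (cis (snd p)) * cis (- (of_int k1 * fst p + of_int k2 * snd p))))" for p
  proof -
    have "((\<lambda>(k1, k2). d (k1, k2) * cis (fst p) powi k1 * cis (snd p) powi k2)
        has_sum g (cis (fst p)) (cis (snd p))) UNIV"
      by (rule g) auto
    then have "((\<lambda>i. d (h i) * cis (fst p) powi fst (h i) * cis (snd p) powi snd (h i))
        has_sum g (cis (fst p)) (cis (snd p))) UNIV"
      by (subst (asm) has_sum_reindex_bij_betw[OF h, symmetric]) (simp add: case_prod_unfold)
    then have "(\<lambda>i. indicator A p *\<^sub>R (d (h i) * cis (fst p) powi fst (h i) *
        cis (snd p) powi snd (h i) * cis (- (of_int k1 * fst p + of_int k2 * snd p)))) sums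
        (indicator A p *\<^sub>R
      (g (cis (fst p)) (cis (snd p)) * cis (- (of_int k1 * fst p + of_int k2 * snd p))))"
      by (intro sums_scaleR_right sums_mult2 has_sum_imp_sums)
    also have "(\<lambda>i. indicator A p *\<^sub>R (d (h i) * cis (fst p) powi fst (h i) *
        cis (snd p) powi snd (h i) * cis (- (of_int k1 * fst p + of_int k2 * snd p)))) = (\<lambda>i. F i p)"
      by (rule ext) (simp add: F_def E_def cis_powi cis_mult mult.assoc algebra_simps)
    finally show ?thesis .
  qed
  have "(\<lambda>i. integral\<^sup>L lborel (F i)) sums (LINT p|lborel. (\<Sum>i. F i p))"
  proof (rule sums_integral[OF int_F])
    show "AE p in lborel. summable (\<lambda>i. norm (F i p))"
      by (intro AE_I2) (simp add: normF summable_mult sm)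
    show "summable (\<lambda>i. LINT p|lborel. norm (F i p))"
      unfolding normF by (simp add: summable_mult sm)
  qed
  also have "(\<lambda>p. \<Sum>i. F i p) = (\<lambda>p. indicator A p *\<^sub>R
      (g (cis (fst p)) (cis (snd p)) * cis (- (of_int k1 * fst p + of_int k2 * snd p))))"
    by (intro ext sums_unique[symmetric] series)
  also have "(LINT p|lborel. \<dots> p) = fourier_coeff g k1 k2 * of_real ((2 * pi)\<^sup>2)"
    by (simp add: fourier_coeff_def A_def set_lebesgue_integral_def)
  finally have 1: "(\<lambda>i. integral\<^sup>L lborel (F i)) sums
      (fourier_coeff g k1 k2 * of_real ((2 * pi)\<^sup>2))" .
  obtain i0 where i0: "h i0 = (k1, k2)" using h by (metis bij_pointE)
  have "integral\<^sup>L lborel (F i) = (if i = i0 then d (k1, k2) * of_real ((2 * pi)\<^sup>2) else 0)" for i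
  proof -
    have "integral\<^sup>L lborel (F i) = d (h i) *
        (if fst (h i) - k1 = 0 \<and> snd (h i) - k2 = 0 then of_real ((2 * pi)\<^sup>2) else 0)"
      unfolding F_def E_def A_def integral_mult_right_zero integral_cis_square ..
    moreover have "fst (h i) - k1 = 0 \<and> snd (h i) - k2 = 0 \<longleftrightarrow> i = i0"
      using h i0 by (auto simp: bij_betw_def inj_def prod_eq_iff)
    ultimately show ?thesis using i0 by auto
  qed
  with 1 have "(\<lambda>i. if i = i0 then d (k1, k2) * of_real ((2 * pi)\<^sup>2) else 0) sums
      (fourier_coeff g k1 k2 * of_real ((2 * pi)\<^sup>2))" by simp
  with sums_single[of i0 "\<lambda>_. d (k1, k2) * of_real ((2 * pi)\<^sup>2)"]
  have "d (k1, k2) * of_real ((2 * pi)\<^sup>2) = fourier_coeff g k1 k2 * of_real ((2 * pi)\<^sup>2)"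
    by (rule sums_unique2)
  then show ?thesis by simp
qed

section \<open>The squared modulus on the torus\<close>

text \<open>
  The frequency of $z_1^m z_2^n\, \overline{z_1^p z_2^q}$ on the torus.
\<close>

definition freq_diff :: "(nat \<times> nat) \<times> (nat \<times> nat) \<Rightarrow> int \<times> int" where
  "freq_diff = (\<lambda>((m, n), (p, q)). (int m - int p, int n - int q))"

definition autocorrelation :: "(nat \<times> nat \<Rightarrow> real) \<Rightarrow> int \<times> int \<Rightarrow> real" where
  "autocorrelation a k = (\<Sum>\<^sub>\<infinity>(x, y)\<in>freq_diff -` {k}. a x * a y)"

lemma autocorrelation_has_sum:
  assumes "a summable_on UNIV" and "\<And>x. a x \<ge> 0"
  shows "((\<lambda>(x, y). a x * a y) has_sum autocorrelation a k) (freq_diff -` {k})"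
  unfolding autocorrelation_def
  by (rule has_sum_infsum, rule summable_on_subset[OF summable_on_product_nonneg])
     (auto intro: assms)

lemma summable_on_autocorrelation:
  assumes "a summable_on UNIV" and "\<And>x. a x \<ge> 0"
  shows "autocorrelation a summable_on UNIV"
  using has_sum_fibres[OF has_sum_infsum[OF summable_on_product_nonneg] autocorrelation_has_sum]
    assms by (metis summable_on_def)

lemma autocorrelation_nonneg:
  assumes "\<And>x. a x \<ge> 0"
  shows "autocorrelation a k \<ge> 0"
  unfolding autocorrelation_def by (rule infsum_nonneg) (auto intro: mult_nonneg_nonneg assms)

lemma cnj_power_unimodular:
  assumes "cmod z = 1"
  shows "z ^ m * cnj (z ^ p) = z powi (int m - int p)"
proof -
  have "z \<noteq> 0" using assms by auto
  moreover have "cnj z = inverse z"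
    using assms by (simp add: divide_inverse[symmetric] inverse_eq_divide complex_div_cnj[of 1])
  ultimately show ?thesis
    by (simp add: power_int_diff divide_inverse power_inverse)
qed

text \<open>
  Since $|z_1| = |z_2| = 1$, the terms of $w \bar w$ have norms $a_x a_y$, so they may be summed
  along the fibres of \<open>freq_diff\<close>; on one fibre the monomial is constant and factors out.
\<close>

lemma has_sum_cmod_square:
  assumes a: "a summable_on UNIV" "\<And>x. a x \<ge> 0"
    and z: "cmod z1 = 1" "cmod z2 = 1"
    and w: "((\<lambda>(m, n). of_real (a (m, n)) * z1 ^ m * z2 ^ n) has_sum w) UNIV"
  shows "((\<lambda>(k1, k2). of_real (autocorrelation a (k1, k2)) * z1 powi k1 * z2 powi k2)
           has_sum of_real ((cmod w)\<^sup>2)) UNIV"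
proof -
  define A where "A = (\<lambda>(m, n). of_real (a (m, n)) * z1 ^ m * z2 ^ n)"
  define F where "F = (\<lambda>(x, y). A x * cnj (A y))"
  have normA: "norm (A x) = a x" for x
    using a(2) z by (cases x) (simp add: A_def norm_mult norm_power)
  have "(\<lambda>x. norm (F x)) summable_on UNIV"
    using summable_on_product_nonneg[OF a(1) a(1) a(2) a(2)]
    by (simp add: F_def norm_mult normA case_prod_unfold)
  then have "F summable_on UNIV" by (rule abs_summable_summable)
  then have F: "(F has_sum infsum F UNIV) (SIGMA x:UNIV. UNIV)"
    by simp
  have wA: "(A has_sum w) UNIV" using w by (simp add: A_def)
  \<comment> \<open>summing the double family row by row identifies its total\<close>
  have "((\<lambda>x. A x * cnj w) has_sum infsum F UNIV) UNIV"
    using F by (rule has_sum_SigmaD) (simp add: F_def has_sum_cmult_right wA)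
  with has_sum_cmult_left[OF wA, of "cnj w"] have "infsum F UNIV = w * cnj w"
    by (rule has_sum_unique[symmetric])
  with F have F': "(F has_sum of_real ((cmod w)\<^sup>2)) UNIV"
    by (simp add: complex_norm_square del: of_real_power)
  show ?thesis
  proof (rule has_sum_fibres[where \<phi> = freq_diff])
    show "(F has_sum of_real ((cmod w)\<^sup>2)) UNIV" using F' .
    fix k :: "int \<times> int"
    obtain k1 k2 where k: "k = (k1, k2)" by fastforce
    have "((\<lambda>x. of_real ((\<lambda>(x, y). a x * a y) x) * (z1 powi k1 * z2 powi k2)) has_sum
        of_real (autocorrelation a k) * (z1 powi k1 * z2 powi k2)) (freq_diff -` {k})"
      by (intro has_sum_cmult_left has_sum_of_real autocorrelation_has_sum a)
    also have "?this \<longleftrightarrow> (F has_sum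
        of_real (autocorrelation a k) * (z1 powi k1 * z2 powi k2)) (freq_diff -` {k})"
    proof (rule has_sum_cong)
      fix x assume "x \<in> freq_diff -` {k}"
      then obtain m n p q where x: "x = ((m, n), (p, q))"
        and k': "int m - int p = k1" "int n - int q = k2"
        by (cases x) (auto simp: freq_diff_def k)
      have "F x = of_real (a (m, n) * a (p, q)) *
          ((z1 ^ m * cnj (z1 ^ p)) * (z2 ^ n * cnj (z2 ^ q)))"
        by (simp add: F_def A_def x)
      also have "\<dots> = of_real (a (m, n) * a (p, q)) * (z1 powi k1 * z2 powi k2)"
        unfolding cnj_power_unimodular[OF z(1)] cnj_power_unimodular[OF z(2)] k' ..
      finally show "of_real ((\<lambda>(x, y). a x * a y) x) * (z1 powi k1 * z2 powi k2) = F x"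
        by (simp add: x)
    qed
    finally show "(F has_sum (case k of (k1, k2) \<Rightarrow>
        of_real (autocorrelation a (k1, k2)) * z1 powi k1 * z2 powi k2)) (freq_diff -` {k})"
      by (simp add: k mult.assoc)
  qed
qed

text \<open>
  For frequencies $k_1, k_2 \ge 0$ the smaller index pair $(p, q)$ parametrises the fibre freely.
\<close>

lemma autocorrelation_pos_antidiagonals:
  assumes "a summable_on UNIV" and "\<And>x. a x \<ge> 0"
  shows "((\<lambda>j. \<Sum>p\<le>j. a (p + k1, j - p + k2) * a (p, j - p)) has_sum
            autocorrelation a (int k1, int k2)) UNIV"
proof -
  have bij: "bij_betw (\<lambda>(p, q). ((p + k1, q + k2), (p, q))) UNIV (freq_diff -` {(int k1, int k2)})"
    by (rule bij_betw_byWitness[where f' = snd]) (auto simp: freq_diff_def)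
  have "((\<lambda>x. a (fst x + k1, snd x + k2) * a x) has_sum
            autocorrelation a (int k1, int k2)) UNIV"
    using autocorrelation_has_sum[OF assms, of "(int k1, int k2)"]
    by (subst (asm) has_sum_reindex_bij_betw[OF bij, symmetric]) (simp add: case_prod_unfold)
  from has_sum_antidiagonals[OF this] show ?thesis by simp
qed

text \<open>
  When the signs are mixed, the pair formed by the smaller exponent of $z_1$ and the
  smaller exponent of $z_2$ parametrises the fibre; the two now come from different factors.
\<close>

lemma autocorrelation_neg_antidiagonals:
  assumes "a summable_on UNIV" and "\<And>x. a x \<ge> 0"
  shows "((\<lambda>j. \<Sum>p\<le>j. a (p + k1, j - p) * a (p, j - p + k2)) has_sum
            autocorrelation a (int k1, - int k2)) UNIV"
proof -
  have bij: "bij_betw (\<lambda>(p, q). ((p + k1, q), (p, q + k2))) UNIV (freq_diff -` {(int k1, - int k2)})"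
    by (rule bij_betw_byWitness[where f' = "\<lambda>((m, n), (p, q)). (p, n)"])
       (auto simp: freq_diff_def)
  have "((\<lambda>x. a (fst x + k1, snd x) * a (fst x, snd x + k2)) has_sum
            autocorrelation a (int k1, - int k2)) UNIV"
    using autocorrelation_has_sum[OF assms, of "(int k1, - int k2)"]
    by (subst (asm) has_sum_reindex_bij_betw[OF bij, symmetric]) (simp add: case_prod_unfold)
  from has_sum_antidiagonals[OF this] show ?thesis by simp
qed

section \<open>The Taylor series on the closed bidisk\<close>

definition taylor_coeff :: "real \<Rightarrow> real \<Rightarrow> nat \<times> nat \<Rightarrow> real" where
  "taylor_coeff r \<alpha> = (\<lambda>(m, n). pochhammer \<alpha> (m + n) / (fact m * fact n * r ^ (m + n)))"

lemma taylor_coeff_nonneg: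
  assumes "r > 2" "\<alpha> \<ge> 0"
  shows "taylor_coeff r \<alpha> x \<ge> 0"
  using assms by (auto simp: taylor_coeff_def case_prod_unfold intro!: divide_nonneg_nonneg
      mult_nonneg_nonneg simp: pochhammer_prod prod_nonneg)

text \<open>
  The binomial theorem for $(z_1 + z_2)^j$. The field is left general: the complex case gives the
  expansion of $f$, and the real case at $z_1 = z_2 = 1$ gives the summability of the coefficients.
\<close>

lemma taylor_coeff_antidiagonal:
  fixes z1 z2 :: "'a :: {real_normed_field, field_char_0}"
  shows "(\<Sum>p\<le>j. of_real (taylor_coeff r \<alpha> (p, j - p)) * z1 ^ p * z2 ^ (j - p)) =
         of_real (pochhammer \<alpha> j / fact j) * ((z1 + z2) / of_real r) ^ j"
proof -
  have "of_real (taylor_coeff r \<alpha> (p, j - p)) * z1 ^ p * z2 ^ (j - p) =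
      of_real (pochhammer \<alpha> j / fact j / r ^ j) *
        (of_nat (j choose p) * z1 ^ p * z2 ^ (j - p))" if "p \<le> j" for p
    using that by (simp add: taylor_coeff_def binomial_fact mult_ac)
  then have "(\<Sum>p\<le>j. of_real (taylor_coeff r \<alpha> (p, j - p)) * z1 ^ p * z2 ^ (j - p)) =
      of_real (pochhammer \<alpha> j / fact j / r ^ j) * (z1 + z2) ^ j"
    by (simp add: binomial_ring sum_distrib_left)
  then show ?thesis by (simp add: power_divide)
qed

text \<open>
  Since $1 - w$ stays in the right half-plane, off the branch cut of the logarithm, the principal
  power of its reciprocal is the power with the opposite exponent, to which the binomial series
  applies.
\<close>

lemma binomial_series_inverse_power:
  fixes w :: complex
  assumes "cmod w < 1"
  shows "(\<lambda>j. of_real (pochhammer \<alpha> j / fact j) * w ^ j) sums (1 / (1 - w)) powr of_real \<alpha>"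
proof -
  have "Re w < 1" using assms complex_Re_le_cmod[of w] by linarith
  then have "1 - w \<notin> \<real>\<^sub>\<le>\<^sub>0"
    by (auto simp: complex_nonpos_Reals_iff)
  moreover from this have "1 - w \<noteq> 0" by auto
  ultimately have "(1 / (1 - w)) powr of_real \<alpha> = (1 + (- w)) powr (- of_real \<alpha>)"
    by (simp add: powr_def Ln_inverse inverse_eq_divide[symmetric])
  moreover have "(- of_real \<alpha> gchoose j) * (- w) ^ j = of_real (pochhammer \<alpha> j / fact j) * w ^ j" for j
    by (simp add: gbinomial_pochhammer power_minus[of w] pochhammer_of_real)
  ultimately show ?thesis
    using gen_binomial_complex[of "- w" "- of_real \<alpha>"] assms by simp
qed

text \<open>
  Grouped along antidiagonals, the coefficients form the binomial series at $2/r < 1$.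
\<close>

lemma summable_on_taylor_coeff:
  assumes "r > 2" "\<alpha> \<ge> 0"
  shows "taylor_coeff r \<alpha> summable_on UNIV"
proof (rule summable_on_antidiagonals)
  have p: "pochhammer \<alpha> j \<ge> 0" for j using assms(2) by (auto simp: pochhammer_prod intro!: prod_nonneg)
  have "summable (\<lambda>j. of_real (pochhammer \<alpha> j / fact j) * (of_real (2 / r) :: complex) ^ j)"
    using binomial_series_inverse_power[of "of_real (2 / r)" \<alpha>] assms(1)
    by (intro sums_summable) (auto simp: norm_divide)
  then have "summable (\<lambda>j. complex_of_real (pochhammer \<alpha> j / fact j * (2 / r) ^ j))" by simp
  then have "summable (\<lambda>j. pochhammer \<alpha> j / fact j * (2 / r) ^ j)" 
    by (subst (asm) summable_of_real_iff)
  then have "(\<lambda>j. pochhammer \<alpha> j / fact j * (2 / r) ^ j) summable_on UNIV"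
    using p assms by (subst summable_on_UNIV_nonneg_real_iff) auto
  then show "(\<lambda>j. \<Sum>p\<le>j. taylor_coeff r \<alpha> (p, j - p)) summable_on UNIV"
    using taylor_coeff_antidiagonal[where ?z1.0 = "1 :: real" and ?z2.0 = 1] by simp
qed (rule taylor_coeff_nonneg[OF assms])

text \<open>
  The Taylor coefficients dominate the terms on the closed bidisk, so the double series converges
  absolutely; grouping it along antidiagonals gives the binomial series at $w = (z_1 + z_2)/r$,
  where $|w| \le 2/r < 1$.
\<close>

lemma pow_fun_has_sum:
  assumes "r > 2" "\<alpha> \<ge> 0" and "cmod z1 \<le> 1" "cmod z2 \<le> 1"
  shows "((\<lambda>(m, n). of_real (taylor_coeff r \<alpha> (m, n)) * z1 ^ m * z2 ^ n)
           has_sum pow_fun r \<alpha> z1 z2) UNIV"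
proof -
  let ?F = "\<lambda>(m, n). of_real (taylor_coeff r \<alpha> (m, n)) * z1 ^ m * z2 ^ n"
  have "(\<lambda>x. norm (?F x)) summable_on UNIV"
  proof (rule summable_on_comparison_test[OF summable_on_taylor_coeff[OF assms(1,2)]])
    show "norm (?F x) \<le> taylor_coeff r \<alpha> x" for x
    proof (cases x)
      case (Pair m n)
      have "cmod z1 ^ m * cmod z2 ^ n \<le> 1"
        using assms(3,4) by (intro mult_le_one power_le_one) auto
      then show ?thesis
        using taylor_coeff_nonneg[OF assms(1,2), of "(m, n)"]
        by (simp add: Pair norm_mult norm_power mult.assoc mult_left_le)
    qed
  qed auto
  then have F: "(?F has_sum infsum ?F UNIV) UNIV"
    by (rule has_sum_infsum[OF abs_summable_summable])
  have "cmod (z1 + z2) \<le> 2" using assms(3,4) norm_triangle_ineq[of z1 z2] by linarith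
  then have "cmod ((z1 + z2) / of_real r) < 1" using assms(1) by (simp add: norm_divide)
  from binomial_series_inverse_power[OF this, of \<alpha>]
  have "(\<lambda>j. of_real (pochhammer \<alpha> j / fact j) * ((z1 + z2) / of_real r) ^ j) sums
      pow_fun r \<alpha> z1 z2" by (simp add: pow_fun_def)
  moreover have "(\<lambda>j. of_real (pochhammer \<alpha> j / fact j) * ((z1 + z2) / of_real r) ^ j) sums
      infsum ?F UNIV"
    using has_sum_imp_sums[OF has_sum_antidiagonals[OF F]] 
    by (simp add: taylor_coeff_antidiagonal)
  ultimately have "pow_fun r \<alpha> z1 z2 = infsum ?F UNIV"
    by (rule sums_unique2)
  then show ?thesis using F by (simp only:)
qed

text \<open>
  A summable nonnegative family is square summable: its squares are the diagonal of the summable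
  double family of products.
\<close>

lemma pow_fun_in_hardy_space:
  assumes "r > 2" "\<alpha> \<ge> 0"
  shows "pow_fun r \<alpha> \<in> hardy_space_bidisk"
  unfolding hardy_space_bidisk_def
proof (intro CollectI exI conjI allI impI)
  let ?a = "\<lambda>m n. complex_of_real (taylor_coeff r \<alpha> (m, n))"
  have "(\<lambda>(x, y). taylor_coeff r \<alpha> x * taylor_coeff r \<alpha> y) summable_on range (\<lambda>x. (x, x))"
    by (rule summable_on_subset[OF summable_on_product_nonneg])
       (auto intro: assms summable_on_taylor_coeff taylor_coeff_nonneg)
  then have "(\<lambda>x. (taylor_coeff r \<alpha> x)\<^sup>2) summable_on UNIV"
    by (subst (asm) summable_on_reindex) (auto simp: inj_on_def o_def power2_eq_square)
  then show "(\<lambda>(m, n). (cmod (?a m n))\<^sup>2) summable_on UNIV"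
    by (simp add: case_prod_unfold)
  show "((\<lambda>(m, n). ?a m n * z1 ^ m * z2 ^ n) has_sum pow_fun r \<alpha> z1 z2) UNIV"
    if "cmod z1 < 1 \<and> cmod z2 < 1" for z1 z2
    using pow_fun_has_sum[OF assms] that by simp
qed

section \<open>Evaluation as hypergeometric series\<close>

lemma fact_add_pochhammer:
  "(fact (j + k) :: real) = fact k * pochhammer (real k + 1) j"
  using pochhammer_product'[of "1 :: real" k j]
  by (simp add: pochhammer_fact[symmetric] add.commute)

text \<open>
  After multiplication by $(j+k_1)!\, (j+k_2)!$ the summand is
  $\binom{j+k_2}{p} \binom{j+k_1}{j-p}$, and the sum over $p$ is the Vandermonde convolution.
\<close>

lemma sum_inverse_factorials_antidiagonal:
  "(\<Sum>p\<le>j. 1 / (fact (p + k1) * fact p * fact (j - p + k2) * fact (j - p)) :: real) =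
   fact (2 * j + k1 + k2) / (fact (j + k1) * fact (j + k2) * fact j * fact (j + k1 + k2))"
proof -
  have "1 / (fact (p + k1) * fact p * fact (j - p + k2) * fact (j - p)) =
      real (((j + k2) choose p) * ((j + k1) choose (j - p))) / (fact (j + k1) * fact (j + k2))"
    if "p \<le> j" for p
    using that by (simp add: binomial_fact field_simps add.commute)
  then have "(\<Sum>p\<le>j. 1 / (fact (p + k1) * fact p * fact (j - p + k2) * fact (j - p)) :: real) =
      real (\<Sum>p\<le>j. ((j + k2) choose p) * ((j + k1) choose (j - p))) / (fact (j + k1) * fact (j + k2))"
    by (simp add: sum_divide_distrib)
  also have "\<dots> = real ((j + k2 + (j + k1)) choose j) / (fact (j + k1) * fact (j + k2))"
    by (subst vandermonde) simp
  also have "\<dots> = fact (2 * j + k1 + k2) / (fact (j + k1) * fact (j + k2) * fact j * fact (j + k1 + k2))"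
  proof -
    have top: "j + k2 + (j + k1) = 2 * j + k1 + k2" and rest: "2 * j + k1 + k2 - j = j + k1 + k2"
      and le: "j \<le> 2 * j + k1 + k2" by simp_all
    show ?thesis
      unfolding top binomial_fact[OF le] rest by (simp add: mult_ac)
  qed
  finally show ?thesis .
qed

text \<open>
  With $K = k_1 + k_2$, the numerator is $(2j+K)! = K!\, (K+1)_{2j}$, and duplication gives
  $(K+1)_{2j} = 4^j (\frac{K+1}{2})_j (\frac{K}{2}+1)_j$.
\<close>

lemma sum_inverse_factorials_pochhammer:
  "(\<Sum>p\<le>j. 1 / (fact (p + k1) * fact p * fact (j - p + k2) * fact (j - p)) :: real) =
   4 ^ j * pochhammer ((real (k1 + k2) + 1) / 2) j * pochhammer (real (k1 + k2) / 2 + 1) j /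
   (fact k1 * fact k2 * fact j * pochhammer (real k1 + 1) j * pochhammer (real k2 + 1) j *
     pochhammer (real (k1 + k2) + 1) j)"
proof -
  let ?z = "(real (k1 + k2) + 1) / 2"
  have twice_z: "2 * ?z = real (k1 + k2) + 1" and next_z: "?z + 1 / 2 = real (k1 + k2) / 2 + 1"
    by (simp_all add: add_divide_distrib)
  have "(fact (2 * j + (k1 + k2)) :: real) = fact (k1 + k2) * pochhammer (2 * ?z) (2 * j)"
    unfolding twice_z by (rule fact_add_pochhammer)
  also have "pochhammer (2 * ?z) (2 * j) =
      4 ^ j * pochhammer ?z j * pochhammer (real (k1 + k2) / 2 + 1) j"
    unfolding pochhammer_double next_z by (simp add: power_mult)
  finally have *: "(fact (2 * j + (k1 + k2)) :: real) = fact (k1 + k2) *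
      (4 ^ j * pochhammer ?z j * pochhammer (real (k1 + k2) / 2 + 1) j)" .
  show ?thesis
    unfolding sum_inverse_factorials_antidiagonal add.assoc[of _ k1 k2] * fact_add_pochhammer[of j]
    by (simp add: mult_ac)
qed

text \<open>
  Dividing by $C$ recovers the hypergeometric series; if $C = 0$, as can happen for $\alpha = 0$,
  both sides vanish whatever value that series is given.
\<close>

lemma sums_hypergeo_cmult:
  assumes "(\<lambda>j. C * (fps_nth (fps_hypergeo as bs 1) j * z ^ j)) sums S"
  shows "S = C * hypergeo as bs z"
proof (cases "C = 0")
  case True
  then show ?thesis using assms sums_unique by fastforce
next
  case False
  then have "(\<lambda>j. fps_nth (fps_hypergeo as bs 1) j * z ^ j) sums (S / C)"
    using sums_divide[OF assms, of C] by simp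
  from sums_unique[OF this] have "S / C = hypergeo as bs z"
    by (simp only: hypergeo_def eval_fps_def)
  then show ?thesis
    using False by (simp add: field_simps)
qed

text \<open>
  On the antidiagonal $p + q = j$ the factor $(\alpha)_{k_1+k_2+j} (\alpha)_j / r^{k_1+k_2+2j}$ is
  constant, and splitting $(\alpha)_{k_1+k_2+j} = (\alpha)_{k_1+k_2} (\alpha+k_1+k_2)_j$
  separates the prefactor from the $j$-th hypergeometric term.
\<close>

lemma autocorrelation_taylor_coeff_pos:
  assumes "r > 2" "\<alpha> \<ge> 0"
  shows "autocorrelation (taylor_coeff r \<alpha>) (int k1, int k2) =
         1 / r ^ (k1 + k2) * (pochhammer \<alpha> (k1 + k2) / (fact k1 * fact k2)) *
          hypergeo [\<alpha>, \<alpha> + real (k1 + k2), real (k1 + k2) / 2 + 1, (real (k1 + k2) + 1) / 2]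
                   [real (k1 + k2) + 1, real k1 + 1, real k2 + 1] (4 / r\<^sup>2)"
    (is "_ = ?C * hypergeo ?as ?bs _")
proof -
  let ?S = "\<lambda>j. \<Sum>p\<le>j. 1 / (fact (p + k1) * fact p * fact (j - p + k2) * fact (j - p))"
  have "(\<Sum>p\<le>j. taylor_coeff r \<alpha> (p + k1, j - p + k2) * taylor_coeff r \<alpha> (p, j - p)) =
      ?C * (fps_nth (fps_hypergeo ?as ?bs 1) j * (4 / r\<^sup>2) ^ j)" for j
  proof -
    have "(\<Sum>p\<le>j. taylor_coeff r \<alpha> (p + k1, j - p + k2) * taylor_coeff r \<alpha> (p, j - p)) =
        pochhammer \<alpha> (k1 + k2 + j) * pochhammer \<alpha> j / r ^ (k1 + k2 + 2 * j) * ?S j"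
      (is "_ = ?X j * _")
      unfolding sum_distrib_left
    proof (intro sum.cong refl)
      fix p assume "p \<in> {..j}"
      then have exponents: "p + k1 + (j - p + k2) = k1 + k2 + j" "p + (j - p) = j" by auto
      show "taylor_coeff r \<alpha> (p + k1, j - p + k2) * taylor_coeff r \<alpha> (p, j - p) = ?X j *
          (1 / (fact (p + k1) * fact p * fact (j - p + k2) * fact (j - p)))"
        unfolding taylor_coeff_def prod.case exponents by (simp add: power_add mult_2 mult_2_right mult_ac)
    qed
    also have "r ^ (k1 + k2 + 2 * j) = r ^ (k1 + k2) * (r\<^sup>2) ^ j"
      by (simp add: power_add power_mult)
    finally show ?thesis
      unfolding sum_inverse_factorials_pochhammer pochhammer_product'[of \<alpha> "k1 + k2" j]
      by (simp add: power_divide mult_ac)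
  qed
  with autocorrelation_pos_antidiagonals[OF summable_on_taylor_coeff taylor_coeff_nonneg,
      OF assms assms, of k1 k2]
  show ?thesis
    by (intro sums_hypergeo_cmult) (simp only: has_sum_imp_sums)
qed

text \<open>
  The constant factor on the antidiagonal is now $(\alpha)_{k_1+j} (\alpha)_{k_2+j} / r^{k_1+k_2+2j}$;
  the reciprocal factorials are the same as for nonnegative frequencies.
\<close>

lemma autocorrelation_taylor_coeff_neg:
  assumes "r > 2" "\<alpha> \<ge> 0"
  shows "autocorrelation (taylor_coeff r \<alpha>) (int k1, - int k2) =
         1 / r ^ (k1 + k2) * (pochhammer \<alpha> k1 * pochhammer \<alpha> k2 / (fact k1 * fact k2)) *
          hypergeo [\<alpha> + real k1, \<alpha> + real k2, (real (k1 + k2) + 1) / 2, real (k1 + k2) / 2 + 1]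
                   [real k1 + 1, real k2 + 1, real (k1 + k2) + 1] (4 / r\<^sup>2)"
    (is "_ = ?C * hypergeo ?as ?bs _")
proof -
  let ?S = "\<lambda>j. \<Sum>p\<le>j. 1 / (fact (p + k1) * fact p * fact (j - p + k2) * fact (j - p))"
  have "(\<Sum>p\<le>j. taylor_coeff r \<alpha> (p + k1, j - p) * taylor_coeff r \<alpha> (p, j - p + k2)) =
      ?C * (fps_nth (fps_hypergeo ?as ?bs 1) j * (4 / r\<^sup>2) ^ j)" for j
  proof -
    have "(\<Sum>p\<le>j. taylor_coeff r \<alpha> (p + k1, j - p) * taylor_coeff r \<alpha> (p, j - p + k2)) =
        pochhammer \<alpha> (k1 + j) * pochhammer \<alpha> (k2 + j) / r ^ (k1 + k2 + 2 * j) * ?S j"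
      (is "_ = ?X j * _")
      unfolding sum_distrib_left
    proof (intro sum.cong refl)
      fix p assume "p \<in> {..j}"
      then have exponents: "p + k1 + (j - p) = k1 + j" "p + (j - p + k2) = k2 + j" by auto
      show "taylor_coeff r \<alpha> (p + k1, j - p) * taylor_coeff r \<alpha> (p, j - p + k2) = ?X j *
          (1 / (fact (p + k1) * fact p * fact (j - p + k2) * fact (j - p)))"
        unfolding taylor_coeff_def prod.case exponents by (simp add: power_add mult_2 mult_2_right mult_ac)
    qed
    also have "r ^ (k1 + k2 + 2 * j) = r ^ (k1 + k2) * (r\<^sup>2) ^ j"
      by (simp add: power_add power_mult)
    finally show ?thesis
      unfolding sum_inverse_factorials_pochhammer pochhammer_product'[of \<alpha> k1 j]
        pochhammer_product'[of \<alpha> k2 j]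
      by (simp add: power_divide mult_ac)
  qed
  with autocorrelation_neg_antidiagonals[OF summable_on_taylor_coeff taylor_coeff_nonneg,
      OF assms assms, of k1 k2]
  show ?thesis
    by (intro sums_hypergeo_cmult) (simp only: has_sum_imp_sums)
qed

theorem theorem1:
  fixes r \<alpha> :: real
    and f :: "complex \<Rightarrow> complex \<Rightarrow> complex"
    and c :: "int \<Rightarrow> int \<Rightarrow> complex"
  assumes "r > 2" and "\<alpha> \<ge> 0"
  defines "f \<equiv> pow_fun r \<alpha>"
  defines "c \<equiv> fourier_coeff (\<lambda>z1 z2. of_real ((cmod (f z1 z2))\<^sup>2))"
  shows "f \<in> hardy_space_bidisk \<and>
    (\<forall>z1 z2. cmod z1 = 1 \<and> cmod z2 = 1 \<longrightarrow>
       ((\<lambda>(k1, k2). c k1 k2 * z1 powi k1 * z2 powi k2)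
          has_sum of_real ((cmod (f z1 z2))\<^sup>2)) UNIV) \<and>
    (\<forall>k1 k2 :: nat.
       c (int k1) (int k2) = of_real
         (1 / r ^ (k1 + k2) * (pochhammer \<alpha> (k1 + k2) / (fact k1 * fact k2)) *
          hypergeo [\<alpha>, \<alpha> + real (k1 + k2), real (k1 + k2) / 2 + 1, (real (k1 + k2) + 1) / 2]
                   [real (k1 + k2) + 1, real k1 + 1, real k2 + 1] (4 / r\<^sup>2)) \<and>
       c (int k1) (- int k2) = of_real
         (1 / r ^ (k1 + k2) * (pochhammer \<alpha> k1 * pochhammer \<alpha> k2 / (fact k1 * fact k2)) *
          hypergeo [\<alpha> + real k1, \<alpha> + real k2, (real (k1 + k2) + 1) / 2, real (k1 + k2) / 2 + 1]
                   [real k1 + 1, real k2 + 1, real (k1 + k2) + 1] (4 / r\<^sup>2)))"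
proof -
  let ?a = "taylor_coeff r \<alpha>"
  note a = summable_on_taylor_coeff[OF assms(1,2)] taylor_coeff_nonneg[OF assms(1,2)]
  have series: "((\<lambda>(k1, k2). of_real (autocorrelation ?a (k1, k2)) * z1 powi k1 * z2 powi k2)
      has_sum of_real ((cmod (f z1 z2))\<^sup>2)) UNIV" if "cmod z1 = 1" "cmod z2 = 1" for z1 z2
    unfolding f_def using that by (intro has_sum_cmod_square a pow_fun_has_sum assms) auto
  have "(\<lambda>k. cmod (of_real (autocorrelation ?a k))) summable_on UNIV"
    using summable_on_autocorrelation[OF a] autocorrelation_nonneg[of ?a, OF a(2)] by simp
  then have c: "c k1 k2 = of_real (autocorrelation ?a (k1, k2))" for k1 k2
    unfolding c_def by (rule fourier_coeff_absolutely_convergent[OF _ series])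
  show ?thesis
    unfolding c autocorrelation_taylor_coeff_pos[OF assms(1,2)]
      autocorrelation_taylor_coeff_neg[OF assms(1,2)]
  proof (intro conjI allI impI refl)
    show "f \<in> hardy_space_bidisk"
      unfolding f_def by (rule pow_fun_in_hardy_space[OF assms(1,2)])
  qed (rule series; simp)
qed

end
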